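(* Let $n\geq4$, let $D_n=\{x\in\mathbb{Z}^n:\sum_{i=1}^n x_i\equiv0\bmod 2\}$ and let $\mathcal{P}$ be the Voronoi region of $D_n$. Then $m_1(\mathbb{R}^n,\Vert\cdot\Vert_{\mathcal{P}})\leq\frac{1}{(3/4)2^n+n-1}$.
   Context: The Voronoi region of a lattice $\Lambda\subset\mathbb{R}^n$ is $\{z:\langle z-x,z-x\rangle\geq\langle z,z\rangle\ \forall x\in\Lambda\}$; it is a convex polytope symmetric about $0$. For such $\mathcal{P}$, $\Vert x\Vert_{\mathcal{P}}=\inf\{\lambda\geq0:x\in\lambda\mathcal{P}\}$. A set $A$ avoids distance $1$ if $\Vert x-y\Vert\neq1$ for all $x,y\in A$. The density of a measurable $A\subset\mathbb{R}^n$ is $\delta(A)=\limsup_{R\to\infty}\operatorname{Vol}(A\cap[-R,R]^n)/\operatorname{Vol}([-R,R]^n)$, and $m_1(\mathbb{R}^n,\Vert\cdot\Vert)$ is the supremum of $\delta(A)$ over measurable $A$ avoiding distance $1$. *)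

theory Defs
  imports "HOL-Analysis.Analysis"
begin

definition Dlat :: "(real ^ 'n) set" where
  "Dlat = {x. (\<forall>i. x $ i \<in> \<int>) \<and> (\<exists>m::int. (\<Sum>i\<in>UNIV. x $ i) = 2 * of_int m)}"

definition voronoi :: "('a::real_inner) set \<Rightarrow> 'a set" where
  "voronoi L = {z. \<forall>x\<in>L. inner (z - x) (z - x) \<ge> inner z z}"

definition gauge_norm :: "('a::real_vector) set \<Rightarrow> 'a \<Rightarrow> real" where
  "gauge_norm P x = Inf {t. t \<ge> 0 \<and> x \<in> (\<lambda>v. t *\<^sub>R v) ` P}"

definition avoids_dist1 :: "('a \<Rightarrow> real) \<Rightarrow> ('a::real_vector) set \<Rightarrow> bool" where
  "avoids_dist1 N A \<longleftrightarrow> (\<forall>x\<in>A. \<forall>y\<in>A. N (x - y) \<noteq> 1)"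

definition cube :: "real \<Rightarrow> (real ^ 'n) set" where
  "cube R = cbox (\<chi> i. - R) (\<chi> i. R)"

definition density :: "(real ^ 'n) set \<Rightarrow> ereal" where
  "density A = Limsup at_top (\<lambda>R::real. ereal (measure lebesgue (A \<inter> cube R) / measure lebesgue (cube R :: (real ^ 'n) set)))"

definition m1 :: "(real ^ 'n \<Rightarrow> real) \<Rightarrow> ereal" where
  "m1 N = Sup {density A | A. A \<in> sets lebesgue \<and> avoids_dist1 N A}"

end

theory Submission
  imports Defs
begin

text \<open>
  The gauge norm of the Voronoi region of $D_n$ is the sum of the two largest absolute values of
  coordinates. Consider the vectors $(\pm 1/4, \dots, \pm 1/4)$ and $\pm e_i/2$, all of norm $1/2$:
  the difference of two of them is zero, another such vector up to sign, or has norm exactly $1$.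
  Hence a set $A$ avoiding distance $1$ admits very few configurations near a point of $A$.
  Now let every point $v$ of space distribute unit mass, evenly among the points of $A$ of the form
  $v - (\pm 1/4, \dots, \pm 1/4)$ if there are any, and otherwise evenly among those of the form
  $v \mp e_i/2$. A point $x \in A$ receives at least $(3/4) 2^n$ in the first way: at most one point
  $x \pm e_i/2$ lies in $A$, and its presence halves the contribution of half of the sign vectors.
  It receives at least $n - 1$ in the second way: the points $x + (\pm 1/4, \dots, \pm 1/4)$
  in $A$ agree in all coordinates but one, and for each common sign the axis direction of the
  opposite sign contributes $1$. Integrating over large cubes gives the density bound.
\<close>

subsection \<open>The norm of the Voronoi region\<close>

lemma int_abs_le_mult_self: "\<bar>m\<bar> \<le> m * m" for m :: int
  by (smt (verit) mult_le_cancel_left1 mult_minus_right mult_cancel_left1)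

lemma ex_other:
  assumes "CARD('n) \<ge> 2"
  shows "\<exists>j::'n. j \<noteq> k"
proof (rule ccontr)
  assume "\<nexists>j::'n. j \<noteq> k"
  then have "(UNIV :: 'n set) = {k}" by auto
  then show False using assms by (metis card_1_singleton_iff One_nat_def not_less_eq_eq numeral_2_eq_2 order_refl)
qed

text \<open>Membership of \<open>z\<close> means \<open>2 * inner z x \<le> inner x x\<close> for
  every lattice vector \<open>x\<close>. The vectors with exactly two nonzero entries, both of
  absolute value 1, give the stated inequalities. Conversely, these imply the condition for all
  other \<open>x\<close>, by the integrality of the entries and the parity of their sum.\<close>

lemma voronoi_Dlat_iff:
  fixes z :: "real ^ 'n"
  assumes "CARD('n) \<ge> 2"
  shows "z \<in> voronoi Dlat \<longleftrightarrow> (\<forall>i j. i \<noteq> j \<longrightarrow> \<bar>z $ i\<bar> + \<bar>z $ j\<bar> \<le> 1)"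
proof
  assume z: "z \<in> voronoi Dlat"
  show "\<forall>i j. i \<noteq> j \<longrightarrow> \<bar>z $ i\<bar> + \<bar>z $ j\<bar> \<le> 1"
  proof (intro allI impI)
    fix i j :: 'n assume ij: "i \<noteq> j"
    \<comment> \<open>The signs follow \<open>z\<close>, so that pairing with \<open>x\<close>
      produces the absolute values.\<close>
    define a b where "a = (if z $ i \<ge> 0 then 1 else -1 :: real)"
      and "b = (if z $ j \<ge> 0 then 1 else -1 :: real)"
    define x :: "real ^ 'n" where "x = axis i a + axis j b"
    have sum_x: "(\<Sum>k\<in>UNIV. x $ k) = a + b"
      by (simp add: x_def sum.distrib axis_def)
    have "x \<in> Dlat"
      unfolding Dlat_def
    proof (intro CollectI conjI allI)
      show "x $ k \<in> \<int>" for k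
        by (auto simp: x_def axis_def a_def b_def)
      show "\<exists>m::int. (\<Sum>k\<in>UNIV. x $ k) = 2 * of_int m"
        unfolding sum_x a_def b_def
        by (auto intro: exI[of _ 1] exI[of _ "-1"] exI[of _ 0])
    qed
    then have "inner z z \<le> inner (z - x) (z - x)"
      using z by (auto simp: voronoi_def)
    then have "2 * inner z x \<le> inner x x"
      by (simp add: inner_diff inner_commute)
    moreover have "inner z x = z $ i * a + z $ j * b"
      by (simp add: x_def inner_add inner_axis)
    moreover have "inner x x = a * a + b * b"
      using ij by (simp add: x_def inner_add inner_axis_axis)
    ultimately show "\<bar>z $ i\<bar> + \<bar>z $ j\<bar> \<le> 1"
      by (auto simp: a_def b_def split: if_splits)
  qed
next
  assume z: "\<forall>i j. i \<noteq> j \<longrightarrow> \<bar>z $ i\<bar> + \<bar>z $ j\<bar> \<le> 1"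
  show "z \<in> voronoi Dlat"
    unfolding voronoi_def
  proof (intro CollectI ballI)
    fix x :: "real ^ 'n" assume x: "x \<in> Dlat"
    have abs_le: "\<bar>x $ i\<bar> \<le> x $ i * x $ i" for i
    proof -
      obtain m where m: "x $ i = of_int m"
        using x by (auto simp: Dlat_def Ints_def)
      have "real_of_int \<bar>m\<bar> \<le> real_of_int (m * m)"
        by (simp only: of_int_le_iff int_abs_le_mult_self)
      then show ?thesis
        by (simp add: m)
    qed
    have "2 * (\<Sum>i\<in>UNIV. z $ i * x $ i) \<le> (\<Sum>i\<in>UNIV. x $ i * x $ i)"
    proof (cases "\<forall>i. \<bar>z $ i\<bar> \<le> 1/2")
      case True
      have "2 * (z $ i * x $ i) \<le> x $ i * x $ i" for i
      proof -
        have "z $ i * x $ i \<le> \<bar>z $ i\<bar> * \<bar>x $ i\<bar>"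
          by (metis abs_ge_self abs_mult)
        also have "\<dots> \<le> 1/2 * \<bar>x $ i\<bar>"
          using True by (intro mult_right_mono) auto
        finally show ?thesis using abs_le[of i] by simp
      qed
      then show ?thesis
        by (simp add: sum_distrib_left sum_mono)
    next
      case False
      then obtain k where k: "\<bar>z $ k\<bar> > 1/2" by (auto simp: not_le)
      \<comment> \<open>Only coordinate \<open>k\<close> can exceed 1/2 in absolute value; all
        others are at most \<open>1 - m\<close>.\<close>
      define m where "m = \<bar>z $ k\<bar>"
      have "\<exists>j::'n. j \<noteq> k" using ex_other[OF assms] .
      then have m: "1/2 < m" "m \<le> 1"
        using k z by (force simp: m_def)+
      let ?X = "\<Sum>i\<in>UNIV - {k}. \<bar>x $ i\<bar>" and ?Q = "\<Sum>i\<in>UNIV - {k}. x $ i * x $ i"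
      have split: "(\<Sum>i\<in>UNIV. f i) = f k + (\<Sum>i\<in>UNIV - {k}. f i)" for f :: "'n \<Rightarrow> real"
        by (simp add: sum.remove)
      have "(\<Sum>i\<in>UNIV - {k}. z $ i * x $ i) \<le> (\<Sum>i\<in>UNIV - {k}. (1 - m) * \<bar>x $ i\<bar>)"
      proof (rule sum_mono)
        fix i assume "i \<in> UNIV - {k}"
        then have "\<bar>z $ i\<bar> \<le> 1 - m" using z by (force simp: m_def)
        then have "\<bar>z $ i\<bar> * \<bar>x $ i\<bar> \<le> (1 - m) * \<bar>x $ i\<bar>"
          by (intro mult_right_mono) auto
        then show "z $ i * x $ i \<le> (1 - m) * \<bar>x $ i\<bar>"
          by (metis abs_ge_self abs_mult order_trans)
      qed
      moreover have "z $ k * x $ k \<le> m * \<bar>x $ k\<bar>"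
        by (metis abs_ge_self abs_mult m_def)
      ultimately have 1: "(\<Sum>i\<in>UNIV. z $ i * x $ i) \<le> m * \<bar>x $ k\<bar> + (1 - m) * ?X"
        by (simp add: split sum_distrib_left)
      have 2: "\<bar>x $ k\<bar> + ?X \<le> x $ k * x $ k + ?Q"
        using abs_le by (intro add_mono sum_mono)
      \<comment> \<open>Here parity enters. If \<open>x\<close> is supported on \<open>k\<close>,
        then \<open>x $ k\<close> is even and the claim is
        \<open>4 * \<bar>l\<bar> \<le> 4 * l * l\<close>. Otherwise \<open>?Q\<close> is at least 1,
        and \<open>2 * \<bar>a\<bar> \<le> a * a + 1\<close> suffices.\<close>
      have 3: "2 * \<bar>x $ k\<bar> \<le> x $ k * x $ k + ?Q"
      proof (cases "?Q = 0")
        case True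
        then have "\<forall>i\<in>UNIV - {k}. x $ i * x $ i = 0"
          by (subst (asm) sum_nonneg_eq_0_iff) auto
        then have "(\<Sum>i\<in>UNIV. x $ i) = x $ k"
          by (simp add: split)
        then obtain l :: int where l: "x $ k = 2 * of_int l"
          using x by (auto simp: Dlat_def)
        have "real_of_int \<bar>l\<bar> \<le> real_of_int (l * l)"
          by (simp only: of_int_le_iff int_abs_le_mult_self)
        then show ?thesis
          by (simp add: l True)
      next
        case False
        then obtain i where i: "i \<noteq> k" "x $ i \<noteq> 0"
          by (force intro: ccontr)
        have "1 \<le> \<bar>x $ i\<bar>"
          using x i by (auto simp: Dlat_def intro: Ints_nonzero_abs_ge1)
        also have "\<dots> \<le> x $ i * x $ i"
          by (rule abs_le)
        also have "\<dots> \<le> ?Q"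
          using i by (intro member_le_sum) auto
        finally show ?thesis
          using sum_squares_bound[of "\<bar>x $ k\<bar>" 1] by (simp add: power2_eq_square)
      qed
      \<comment> \<open>The bound is affine in \<open>m\<close>, so the endpoints \<open>m = 1/2\<close> (fact 2) and \<open>m = 1\<close> (fact 3) suffice.\<close>
      have "2 * (m * \<bar>x $ k\<bar> + (1 - m) * ?X)
        = (2 * m - 1) * (2 * \<bar>x $ k\<bar>) + (2 - 2 * m) * (\<bar>x $ k\<bar> + ?X)"
        by (simp add: algebra_simps)
      also have "\<dots> \<le> (2 * m - 1) * (x $ k * x $ k + ?Q) + (2 - 2 * m) * (x $ k * x $ k + ?Q)"
        using m by (intro add_mono[OF mult_left_mono[OF 3] mult_left_mono[OF 2]]) auto
      also have "\<dots> = (\<Sum>i\<in>UNIV. x $ i * x $ i)"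
        by (simp add: split algebra_simps)
      finally show ?thesis using 1 by simp
    qed
    then have "2 * inner z x \<le> inner x x"
      by (simp add: inner_vec_def)
    then show "inner z z \<le> inner (z - x) (z - x)"
      by (simp add: inner_diff inner_commute)
  qed
qed

text \<open>The vector lies in the region, so \<open>t = 1\<close> is admissible. The facet
  inequality that is tight at \<open>u\<close> scales linearly with \<open>t\<close>, which excludes
  smaller \<open>t\<close>.\<close>

lemma gauge_norm_voronoi_Dlat_eq_1:
  fixes u :: "real ^ 'n"
  assumes "CARD('n) \<ge> 2" and le: "\<And>i j. i \<noteq> j \<Longrightarrow> \<bar>u $ i\<bar> + \<bar>u $ j\<bar> \<le> 1"
    and "i \<noteq> j" "\<bar>u $ i\<bar> + \<bar>u $ j\<bar> = 1"
  shows "gauge_norm (voronoi Dlat) u = 1"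
  unfolding gauge_norm_def
proof (rule cInf_eq_minimum)
  show "1 \<in> {t. t \<ge> 0 \<and> u \<in> (\<lambda>v. t *\<^sub>R v) ` voronoi Dlat}"
    using voronoi_Dlat_iff[OF assms(1), of u] le by auto
next
  fix t assume "t \<in> {t. t \<ge> 0 \<and> u \<in> (\<lambda>v. t *\<^sub>R v) ` voronoi Dlat}"
  then obtain v where t: "t \<ge> 0" and v: "v \<in> voronoi Dlat" "u = t *\<^sub>R v" by auto
  have "\<bar>v $ i\<bar> + \<bar>v $ j\<bar> \<le> 1"
    using v voronoi_Dlat_iff[OF assms(1)] assms(3) by auto
  then have "t * (\<bar>v $ i\<bar> + \<bar>v $ j\<bar>) \<le> t * 1"
    using t by (intro mult_left_mono)
  then show "1 \<le> t"
    using assms(4) t v(2) by (simp add: abs_mult algebra_simps)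
qed

subsection \<open>Density bounds by mass transport\<close>

lemma measure_cube:
  assumes "R \<ge> 0"
  shows "measure lborel (cube R :: (real ^ 'n) set) = (2 * R) ^ CARD('n)"
proof -
  have "(\<chi> i. - R) \<in> (cube R :: (real ^ 'n) set)"
    using assms by (auto simp: cube_def mem_box_cart)
  then have "cbox (\<chi> i. - R) (\<chi> i. R) \<noteq> ({} :: (real ^ 'n) set)"
    by (auto simp: cube_def)
  from content_cbox_cart[OF this] show ?thesis
    by (simp add: cube_def)
qed

lemma emeasure_cube:
  assumes "R \<ge> 0"
  shows "emeasure lborel (cube R :: (real ^ 'n) set) = ennreal ((2 * R) ^ CARD('n))"
proof -
  have "emeasure lborel (cube R :: (real ^ 'n) set) \<noteq> \<infinity>"
    unfolding cube_def using emeasure_lborel_cbox_finite by (auto simp: top.not_eq_extremum)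
  then show ?thesis
    using measure_cube[OF assms] by (metis emeasure_eq_ennreal_measure infinity_ennreal_def)
qed

lemma nn_integral_lborel_translate:
  fixes c :: "'a::euclidean_space"
  assumes [measurable]: "f \<in> borel_measurable borel"
  shows "(\<integral>\<^sup>+ x. f (c + x) \<partial>lborel) = (\<integral>\<^sup>+ x. f x \<partial>lborel)"
  by (subst (2) lborel_distr_plus[symmetric, of c], subst nn_integral_distr) auto

lemma sets_cube [measurable]: "cube R \<in> sets borel"
  by (simp add: cube_def)

text \<open>Enlarging the cube by a fixed \<open>c\<close> changes its volume by the factor
  \<open>((R + c) / R) ^ CARD('n)\<close>, which tends to 1.\<close>

lemma Limsup_density_le:
  fixes A :: "(real ^ 'n) set"
  assumes K: "K > 0" and c: "c \<ge> 0"
    and le: "\<And>R. R > 0 \<Longrightarrow> K * measure lebesgue (A \<inter> cube R) \<le> measure lborel (cube (R + c) :: (real ^ 'n) set)"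
  shows "density A \<le> ereal (1 / K)"
proof -
  have "density A \<le> Limsup at_top (\<lambda>R. ereal (1 / K * ((R + c) / R) ^ CARD('n)))"
    unfolding density_def
  proof (rule Limsup_mono, rule eventually_mono[OF eventually_gt_at_top[of 0]])
    fix R :: real assume R: "R > 0"
    have "measure lebesgue (A \<inter> cube R) \<le> (2 * (R + c)) ^ CARD('n) / K"
      using le[OF R] K measure_cube[of "R + c", where 'n = 'n] R c by (simp add: field_simps)
    then have "measure lebesgue (A \<inter> cube R) / (2 * R) ^ CARD('n)
        \<le> (2 * (R + c)) ^ CARD('n) / K / (2 * R) ^ CARD('n)"
      using R by (intro divide_right_mono) auto
    also have "\<dots> = 1 / K * ((R + c) / R) ^ CARD('n)"
      unfolding power_mult_distrib power_divide using R by simp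
    finally show "ereal (measure lebesgue (A \<inter> cube R) / measure lebesgue (cube R :: (real ^ 'n) set))
        \<le> ereal (1 / K * ((R + c) / R) ^ CARD('n))"
      using measure_cube[of R, where 'n = 'n] R by (simp add: measure_completion)
  qed
  also have "\<dots> = ereal (1 / K)"
  proof (rule lim_imp_Limsup)
    have "((\<lambda>R. c / R) \<longlongrightarrow> 0) at_top"
      by (intro tendsto_divide_0[OF tendsto_const] filterlim_at_top_imp_at_infinity filterlim_ident)
    from tendsto_add[OF tendsto_const[of 1] this] have "((\<lambda>R. 1 + c / R) \<longlongrightarrow> 1) at_top"
      by simp
    moreover have "\<forall>\<^sub>F R in at_top. 1 + c / R = (R + c) / R"
      by (rule eventually_mono[OF eventually_gt_at_top[of 0]]) (simp add: field_simps)
    ultimately have "((\<lambda>R. (R + c) / R) \<longlongrightarrow> 1) at_top"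
      by (rule Lim_transform_eventually)
    then have "((\<lambda>R. 1 / K * ((R + c) / R) ^ CARD('n)) \<longlongrightarrow> 1 / K * 1 ^ CARD('n)) at_top"
      by (intro tendsto_intros)
    then show "((\<lambda>R. ereal (1 / K * ((R + c) / R) ^ CARD('n))) \<longlongrightarrow> ereal (1 / K)) at_top"
      by simp
  qed simp
  finally show ?thesis .
qed

text \<open>Double counting by integration: \<open>w i v\<close> is the mass sent from
  \<open>v\<close> to \<open>v - g i\<close>. Integrating the received mass over
  \<open>A \<inter> cube R\<close> and translating each summand by \<open>g i\<close> turns it into
  an integral of sent mass, at most 1 at each \<open>v\<close>.\<close>

lemma mass_transport_cube:
  fixes A :: "(real ^ 'n) set" and g :: "'i \<Rightarrow> real ^ 'n" and w :: "'i \<Rightarrow> real ^ 'n \<Rightarrow> real"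
  assumes "finite I" and A [measurable]: "A \<in> sets borel"
    and w [measurable]: "\<And>i. i \<in> I \<Longrightarrow> w i \<in> borel_measurable borel"
    and w_nonneg: "\<And>i v. i \<in> I \<Longrightarrow> w i v \<ge> 0"
    and g: "\<And>i k. i \<in> I \<Longrightarrow> \<bar>g i $ k\<bar> \<le> c"
    and out: "\<And>v. (\<Sum>i\<in>I. indicator A (v - g i) * w i v) \<le> 1"
    and inn: "\<And>x. x \<in> A \<Longrightarrow> K \<le> (\<Sum>i\<in>I. w i (x + g i))"
    and "K \<ge> 0" "c \<ge> 0" "R \<ge> 0"
  shows "K * measure lborel (A \<inter> cube R) \<le> measure lborel (cube (R + c) :: (real ^ 'n) set)"
proof -
  let ?Q = "cube R :: (real ^ 'n) set" and ?Q' = "cube (R + c) :: (real ^ 'n) set"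
  have "ennreal K * emeasure lborel (A \<inter> ?Q) = (\<integral>\<^sup>+ x. ennreal K * indicator (A \<inter> ?Q) x \<partial>lborel)"
    by (simp add: nn_integral_cmult)
  also have "\<dots> \<le> (\<integral>\<^sup>+ x. (\<Sum>i\<in>I. ennreal (w i (g i + x)) * indicator (A \<inter> ?Q) x) \<partial>lborel)"
  proof (rule nn_integral_mono)
    fix x :: "real ^ 'n"
    show "ennreal K * indicator (A \<inter> ?Q) x \<le> (\<Sum>i\<in>I. ennreal (w i (g i + x)) * indicator (A \<inter> ?Q) x)"
    proof (cases "x \<in> A \<inter> ?Q")
      case True
      then have "ennreal K \<le> ennreal (\<Sum>i\<in>I. w i (g i + x))"
        using inn[of x] by (simp add: add.commute ennreal_leI)
      then show ?thesis
        using True w_nonneg by (simp add: sum_ennreal)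
    qed simp
  qed
  also have "\<dots> = (\<Sum>i\<in>I. \<integral>\<^sup>+ x. ennreal (w i (g i + x)) * indicator (A \<inter> ?Q) x \<partial>lborel)"
    by (rule nn_integral_sum) measurable
  \<comment> \<open>Writing \<open>x\<close> as \<open>(g i + x) - g i\<close> exhibits the
    integrand as a translate.\<close>
  also have "\<dots> = (\<Sum>i\<in>I. \<integral>\<^sup>+ x. (\<lambda>v. ennreal (w i v) * indicator (A \<inter> ?Q) (v - g i)) (g i + x) \<partial>lborel)"
    by simp
  also have "\<dots> = (\<Sum>i\<in>I. \<integral>\<^sup>+ v. ennreal (w i v) * indicator (A \<inter> ?Q) (v - g i) \<partial>lborel)"
    by (intro sum.cong refl nn_integral_lborel_translate) measurable
  also have "\<dots> = (\<integral>\<^sup>+ v. (\<Sum>i\<in>I. ennreal (w i v) * indicator (A \<inter> ?Q) (v - g i)) \<partial>lborel)"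
    by (rule nn_integral_sum[symmetric]) measurable
  also have "\<dots> \<le> (\<integral>\<^sup>+ v. indicator ?Q' v \<partial>lborel)"
  proof (rule nn_integral_mono)
    fix v :: "real ^ 'n"
    show "(\<Sum>i\<in>I. ennreal (w i v) * indicator (A \<inter> ?Q) (v - g i)) \<le> indicator ?Q' v"
    proof (cases "v \<in> ?Q'")
      case True
      have "(\<Sum>i\<in>I. ennreal (w i v) * indicator (A \<inter> ?Q) (v - g i))
          \<le> (\<Sum>i\<in>I. ennreal (indicator A (v - g i) * w i v))"
        by (intro sum_mono) (auto simp: indicator_def)
      also have "\<dots> = ennreal (\<Sum>i\<in>I. indicator A (v - g i) * w i v)"
        using w_nonneg by (intro sum_ennreal) auto
      also have "\<dots> \<le> ennreal 1"
        by (intro ennreal_leI out)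
      finally show ?thesis using True by simp
    next
      case False
      \<comment> \<open>Steps have coordinates at most \<open>c\<close>, so no mass enters
        \<open>cube R\<close> from outside the enlarged cube.\<close>
      have "v - g i \<notin> ?Q" if i: "i \<in> I" for i
      proof
        assume "v - g i \<in> ?Q"
        then have "- R \<le> v $ k - g i $ k \<and> v $ k - g i $ k \<le> R" for k
          by (auto simp: cube_def mem_box_cart)
        then have "- (R + c) \<le> v $ k \<and> v $ k \<le> R + c" for k
          using g[OF i, of k] by (smt (verit))
        then show False using False by (auto simp: cube_def mem_box_cart)
      qed
      then show ?thesis by (auto simp: indicator_def intro!: sum_nonpos)
    qed
  qed
  also have "\<dots> = emeasure lborel ?Q'"
    by simp
  finally have "ennreal K * emeasure lborel (A \<inter> ?Q) \<le> emeasure lborel ?Q'" .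
  moreover have "emeasure lborel (A \<inter> ?Q) \<le> emeasure lborel ?Q"
    by (intro emeasure_mono) auto
  then have "emeasure lborel (A \<inter> ?Q) < \<infinity>"
    using emeasure_cube[of R, where 'n = 'n] \<open>R \<ge> 0\<close> by (auto simp: less_top[symmetric] top_unique)
  then have "emeasure lborel (A \<inter> ?Q) = ennreal (measure lborel (A \<inter> ?Q))"
    by (intro emeasure_eq_ennreal_measure) auto
  ultimately show ?thesis
    using emeasure_cube[of "R + c", where 'n = 'n] measure_cube[of "R + c", where 'n = 'n] assms(8-10)
    by (simp flip: ennreal_mult)
qed

text \<open>A Lebesgue set is a Borel set \<open>B\<close> up to a null set, and the transport is
  run on \<open>B\<close>. The weights therefore take the set as an argument, and \<open>P\<close>
  must pass to subsets.\<close>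

lemma density_le_of_mass_transport:
  fixes A :: "(real ^ 'n) set" and g :: "'i \<Rightarrow> real ^ 'n"
    and w :: "(real ^ 'n) set \<Rightarrow> 'i \<Rightarrow> real ^ 'n \<Rightarrow> real"
  assumes "finite I" and A: "A \<in> sets lebesgue" "P A"
    and P_subset: "\<And>B. B \<subseteq> A \<Longrightarrow> P B"
    and w: "\<And>B i. B \<in> sets borel \<Longrightarrow> i \<in> I \<Longrightarrow> w B i \<in> borel_measurable borel"
    and w_nonneg: "\<And>B i v. i \<in> I \<Longrightarrow> w B i v \<ge> 0"
    and out: "\<And>B v. (\<Sum>i\<in>I. indicator B (v - g i) * w B i v) \<le> 1"
    and inn: "\<And>B x. P B \<Longrightarrow> x \<in> B \<Longrightarrow> K \<le> (\<Sum>i\<in>I. w B i (x + g i))"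
    and K: "K > 0"
  shows "density A \<le> ereal (1 / K)"
proof -
  obtain B T where B: "fsigma B" and T: "T \<in> null_sets lebesgue" and BT: "B \<union> T = A" "disjnt B T"
    using lebesgue_set_almost_fsigma[OF A(1)] .
  have [measurable]: "B \<in> sets borel"
    using B by (auto elim!: fsigma.cases)
  have "P B" using P_subset BT by auto
  define c where "c = (\<Sum>i\<in>I. norm (g i))"
  have "c \<ge> 0" by (simp add: c_def sum_nonneg)
  have g: "\<bar>g i $ k\<bar> \<le> c" if "i \<in> I" for i k
  proof -
    have "\<bar>g i $ k\<bar> \<le> norm (g i)" by (rule component_le_norm_cart)
    also have "\<dots> \<le> c" unfolding c_def using that \<open>finite I\<close> by (intro member_le_sum) auto
    finally show ?thesis .
  qed
  have "measure lebesgue (A \<inter> cube R) = measure lborel (B \<inter> cube R)" for R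
  proof -
    have "T \<inter> cube R \<in> null_sets lebesgue"
      using T by (intro null_set_Int2) auto
    then have "measure lebesgue ((B \<inter> cube R) \<union> (T \<inter> cube R)) = measure lebesgue (B \<inter> cube R)"
      by (intro measure_Un_null_set) auto
    moreover have "A \<inter> cube R = (B \<inter> cube R) \<union> (T \<inter> cube R)" using BT by auto
    ultimately show ?thesis by (simp add: measure_completion)
  qed
  then show ?thesis
    using mass_transport_cube[OF \<open>finite I\<close> \<open>B \<in> sets borel\<close> w w_nonneg g out inn] K \<open>c \<ge> 0\<close> \<open>P B\<close>
    by (intro Limsup_density_le[OF K \<open>c \<ge> 0\<close>]) auto
qed

subsection \<open>The discharging rule\<close>

definition halfcube :: "'n set \<Rightarrow> real ^ 'n" where
  "halfcube J = (\<chi> k. if k \<in> J then 1/4 else - 1/4)"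

definition halfaxis :: "'n \<times> bool \<Rightarrow> real ^ 'n" where
  "halfaxis p = axis (fst p) (if snd p then 1/2 else - 1/2)"

text \<open>The symmetric difference of \<open>J\<close> and \<open>{i}\<close>: the sign of
  coordinate \<open>i\<close> is reversed.\<close>

definition flip :: "'n \<Rightarrow> 'n set \<Rightarrow> 'n set" where
  "flip i J = {k. (k \<in> J) \<longleftrightarrow> k \<noteq> i}"

definition cube_nbrs :: "(real ^ 'n) set \<Rightarrow> real ^ 'n \<Rightarrow> 'n set set" where
  "cube_nbrs A v = {J. v - halfcube J \<in> A}"

definition axis_nbrs :: "(real ^ 'n) set \<Rightarrow> real ^ 'n \<Rightarrow> ('n \<times> bool) set" where
  "axis_nbrs A v = {p. v - halfaxis p \<in> A}"

definition step :: "'n set + 'n \<times> bool \<Rightarrow> real ^ 'n" where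
  "step = case_sum halfcube halfaxis"

text \<open>The mass that \<open>v\<close> sends to \<open>v - step s\<close>, meaningful when that
  point lies in \<open>A\<close>; elsewhere an indicator of \<open>A\<close> removes it.\<close>

definition weight :: "(real ^ 'n) set \<Rightarrow> 'n set + 'n \<times> bool \<Rightarrow> real ^ 'n \<Rightarrow> real" where
  "weight A s v = (case s of
     Inl J \<Rightarrow> 1 / real (card (cube_nbrs A v))
   | Inr p \<Rightarrow> if cube_nbrs A v = {} then 1 / real (card (axis_nbrs A v)) else 0)"

abbreviation avoids_Dn :: "(real ^ 'n) set \<Rightarrow> bool" where
  "avoids_Dn A \<equiv> avoids_dist1 (gauge_norm (voronoi Dlat)) A"

section \<open>Configurations excluded by avoiding distance 1\<close>

lemma avoids_DnD:
  fixes A :: "(real ^ 'n) set"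
  assumes "CARD('n) \<ge> 2" "avoids_Dn A" "x \<in> A" "y \<in> A"
    and "\<And>i j. i \<noteq> j \<Longrightarrow> \<bar>x $ i - y $ i\<bar> + \<bar>x $ j - y $ j\<bar> \<le> 1"
    and "i \<noteq> j" "\<bar>x $ i - y $ i\<bar> + \<bar>x $ j - y $ j\<bar> = 1"
  shows False
  using gauge_norm_voronoi_Dlat_eq_1[of "x - y" i j] assms by (auto simp: avoids_dist1_def)

lemma halfcube_diff_flip:
  "halfcube J - halfcube (flip i J) = halfaxis (i, i \<in> J)"
  by (auto simp: vec_eq_iff halfcube_def halfaxis_def flip_def axis_def)

text \<open>The difference of two sign vectors has entries 0 or 1/2 in absolute value. Two nonzero
  entries would give norm 1.\<close>

lemma avoids_halfcube:
  fixes A :: "(real ^ 'n) set"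
  assumes n: "CARD('n) \<ge> 2" and A: "avoids_Dn A"
    and x: "x + halfcube J - halfcube J' \<in> A" "x \<in> A" and "J \<noteq> J'"
  obtains i where "J' = flip i J"
proof -
  obtain i where i: "(i \<in> J) \<noteq> (i \<in> J')" using \<open>J \<noteq> J'\<close> by auto
  have "(k \<in> J) = (k \<in> J')" if "k \<noteq> i" for k
  proof (rule ccontr)
    assume "(k \<in> J) \<noteq> (k \<in> J')"
    then show False
      using i that by (intro avoids_DnD[OF n A x, of k i]) (auto simp: halfcube_def)
  qed
  then have "J' = flip i J" using i by (auto simp: flip_def)
  then show ?thesis by (rule that)
qed

lemma avoids_halfaxis:
  fixes A :: "(real ^ 'n) set"
  assumes n: "CARD('n) \<ge> 2" and A: "avoids_Dn A"
    and x: "x + halfaxis p \<in> A" "x + halfaxis q \<in> A"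
  shows "p = q"
proof (rule ccontr)
  assume "p \<noteq> q"
  show False
  proof (cases "fst p = fst q")
    case True
    then have b: "snd p \<noteq> snd q" using \<open>p \<noteq> q\<close> by (simp add: prod_eq_iff)
    \<comment> \<open>The difference is a unit vector up to sign; a zero entry at \<open>j\<close>
      completes the tight pair.\<close>
    obtain j where j: "j \<noteq> fst p" using ex_other[OF n] by blast
    show False
      using True b j
      by (intro avoids_DnD[OF n A x, of "fst p" j]) (auto simp: halfaxis_def axis_def)
  next
    case False
    then show False
      by (intro avoids_DnD[OF n A x, of "fst p" "fst q"]) (auto simp: halfaxis_def axis_def)
  qed
qed

text \<open>Seen from \<open>x + halfaxis p\<close>, both points are half-axis neighbours, with the
  signs of \<open>p\<close> and \<open>q\<close> reversed.\<close>

lemma avoids_halfaxis_diff: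
  fixes A :: "(real ^ 'n) set"
  assumes n: "CARD('n) \<ge> 2" and A: "avoids_Dn A"
    and x: "x + halfaxis p - halfaxis q \<in> A" "x \<in> A"
  shows "p = q"
proof -
  have "halfaxis (fst q, \<not> snd q) = - halfaxis q"
    by (auto simp: halfaxis_def vec_eq_iff axis_def)
  moreover have "halfaxis (fst p, \<not> snd p) = - halfaxis p"
    by (auto simp: halfaxis_def vec_eq_iff axis_def)
  ultimately have "(fst p, \<not> snd p) = (fst q, \<not> snd q)"
    using x by (intro avoids_halfaxis[OF n A, of "x + halfaxis p"]) auto
  then show ?thesis by (simp add: prod_eq_iff)
qed

text \<open>If \<open>J\<close> disagrees with \<open>b\<close> at \<open>i\<close>, the difference
  has entry 3/4 there and 1/4 elsewhere in absolute value, hence norm 1. Otherwise it is again a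
  sign vector, with sign \<open>b\<close> at \<open>i\<close>.\<close>

lemma avoids_halfaxis_halfcube:
  fixes A :: "(real ^ 'n) set"
  assumes n: "CARD('n) \<ge> 2" and A: "avoids_Dn A"
    and x: "x + halfaxis (i, b) - halfcube J \<in> A" "x \<in> A"
  obtains J' where "x + halfcube J' \<in> A" "(i \<in> J') = b"
proof -
  have "(i \<in> J) = b"
  proof (rule ccontr)
    assume "(i \<in> J) \<noteq> b"
    moreover obtain j where "j \<noteq> i" using ex_other[OF n] by blast
    ultimately show False
      by (intro avoids_DnD[OF n A x, of i j]) (auto simp: halfaxis_def axis_def halfcube_def)
  qed
  then have "halfaxis (i, b) - halfcube J = halfcube (flip i (- J))"
    by (auto simp: vec_eq_iff halfaxis_def axis_def halfcube_def flip_def)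
  with x have "x + halfcube (flip i (- J)) \<in> A"
    by (simp add: add_diff_eq[symmetric])
  moreover have "(i \<in> flip i (- J)) = b"
    using \<open>(i \<in> J) = b\<close> by (auto simp: flip_def)
  ultimately show ?thesis by (rule that)
qed

section \<open>Mass sent and mass received\<close>

lemma sum_UNIV_sum:
  fixes f :: "'a::finite + 'b::finite \<Rightarrow> 'c::comm_monoid_add"
  shows "(\<Sum>s\<in>UNIV. f s) = (\<Sum>a\<in>UNIV. f (Inl a)) + (\<Sum>b\<in>UNIV. f (Inr b))"
  unfolding UNIV_Plus_UNIV[symmetric] by (subst sum.Plus) auto

lemma card_nbrs:
  "real (card (cube_nbrs A v)) = (\<Sum>J\<in>UNIV. indicator A (v - halfcube J))"
  "real (card (axis_nbrs A v)) = (\<Sum>p\<in>UNIV. indicator A (v - halfaxis p))"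
  by (simp_all add: cube_nbrs_def axis_nbrs_def indicator_def sum.If_cases)

lemma sum_weight_out:
  fixes A :: "(real ^ 'n) set"
  shows "(\<Sum>s\<in>UNIV. indicator A (v - step s) * weight A s v) \<le> 1"
proof -
  have "(\<Sum>s\<in>UNIV. indicator A (v - step s) * weight A s v) =
    real (card (cube_nbrs A v)) * (1 / real (card (cube_nbrs A v))) +
    real (card (axis_nbrs A v)) * (if cube_nbrs A v = {} then 1 / real (card (axis_nbrs A v)) else 0)"
    by (simp only: sum_UNIV_sum step_def weight_def sum.case flip: card_nbrs sum_distrib_right)
  \<comment> \<open>At most one summand is nonzero. Each product is 0 or 1, since
    \<open>1 / 0 = 0\<close> covers points without neighbours.\<close>
  also have "\<dots> \<le> 1"
    by auto
  finally show ?thesis .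
qed

text \<open>Exactly one of \<open>J\<close> and its complement has sign \<open>b\<close> at
  \<open>i\<close>, so each such pair contributes 3/2.\<close>

lemma sum_halves_halfspace:
  fixes i :: "'n :: finite"
  shows "(\<Sum>J\<in>UNIV. if (i \<in> J) = b then 1/2 else 1 :: real) = 3/4 * 2 ^ CARD('n)"
proof -
  let ?f = "\<lambda>J. if (i \<in> J) = b then 1/2 else 1 :: real"
  have "(\<Sum>J\<in>UNIV. ?f J) = (\<Sum>J\<in>UNIV. ?f (- J))"
    by (rule sum.reindex_bij_witness[where i = uminus and j = uminus]) auto
  then have "2 * (\<Sum>J\<in>UNIV. ?f J) = (\<Sum>J\<in>UNIV. ?f J + ?f (- J))"
    by (simp add: sum.distrib)
  also have "\<dots> = (\<Sum>J\<in>(UNIV :: 'n set set). 3/2)"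
    by (intro sum.cong) auto
  also have "\<dots> = 3/2 * 2 ^ CARD('n)"
    by (simp add: card_UNIV_set)
  finally show ?thesis by simp
qed

text \<open>If \<open>x + halfcube J\<close> is also adjacent to a second point of \<open>A\<close>,
  that point is \<open>x + halfaxis (i, i \<in> J)\<close> for some \<open>i\<close>. By
  \<open>avoids_halfaxis\<close> this fixes both \<open>i\<close> and the sign, so sharing occurs
  only on one side of one coordinate.\<close>

lemma sum_weight_cube:
  fixes A :: "(real ^ 'n) set"
  assumes n: "CARD('n) \<ge> 2" and A: "avoids_Dn A" and x: "x \<in> A"
  shows "3/4 * 2 ^ CARD('n) \<le> (\<Sum>J\<in>UNIV. weight A (Inl J) (x + halfcube J))"
proof -
  have self: "J \<in> cube_nbrs A (x + halfcube J)" for J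
    using x by (simp add: cube_nbrs_def)
  have nbr: "\<exists>i. J' = flip i J \<and> x + halfaxis (i, i \<in> J) \<in> A"
    if "J' \<in> cube_nbrs A (x + halfcube J)" "J' \<noteq> J" for J J'
    using that avoids_halfcube[OF n A _ x, of J J'] halfcube_diff_flip[of J]
    by (metis add_diff_eq cube_nbrs_def mem_Collect_eq)
  have "\<exists>i b. \<forall>J. cube_nbrs A (x + halfcube J) \<subseteq> (if (i \<in> J) = b then {J, flip i J} else {J})"
  proof (cases "\<exists>p. x + halfaxis p \<in> A")
    case True
    then obtain i b where ib: "x + halfaxis (i, b) \<in> A" by auto
    have "J' \<in> (if (i \<in> J) = b then {J, flip i J} else {J})"
      if J': "J' \<in> cube_nbrs A (x + halfcube J)" for J J'
    proof (cases "J' = J")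
      case False
      then obtain j where j: "J' = flip j J" "x + halfaxis (j, j \<in> J) \<in> A"
        using nbr[OF J' False] by blast
      then have "(j, j \<in> J) = (i, b)" using avoids_halfaxis[OF n A _ ib] by blast
      then show ?thesis using j by auto
    qed auto
    then show ?thesis by blast
  next
    case False
    \<comment> \<open>Nothing is shared here, so any \<open>i\<close> and \<open>b\<close>
      serve.\<close>
    have "J' \<in> (if (i \<in> J) = b then {J, flip i J} else {J})"
      if "J' \<in> cube_nbrs A (x + halfcube J)" for J J' i b
      using nbr[OF that] False by auto
    then show ?thesis by blast
  qed
  then obtain i b where ib:
    "\<And>J. cube_nbrs A (x + halfcube J) \<subseteq> (if (i \<in> J) = b then {J, flip i J} else {J})"
    by blast
  have "(if (i \<in> J) = b then 1/2 else 1) \<le> weight A (Inl J) (x + halfcube J)" for J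
  proof -
    have "card (cube_nbrs A (x + halfcube J)) \<le> card (if (i \<in> J) = b then {J, flip i J} else {J})"
      by (intro card_mono ib) auto
    also have "\<dots> \<le> (if (i \<in> J) = b then 2 else 1)"
      by (simp add: card_insert_if)
    finally have "real (card (cube_nbrs A (x + halfcube J))) \<le> (if (i \<in> J) = b then 2 else 1)"
      by (auto split: if_splits)
    moreover have "card (cube_nbrs A (x + halfcube J)) > 0"
      using self by (auto simp: card_gt_0_iff)
    ultimately show ?thesis
      by (auto simp: weight_def field_simps split: if_splits)
  qed
  then show ?thesis
    unfolding sum_halves_halfspace[symmetric, of i b] by (intro sum_mono)
qed

text \<open>By \<open>avoids_halfaxis_halfcube\<close>, a cube neighbour of
  \<open>x + halfaxis (i, b)\<close> forces a member of \<open>?D\<close> with sign \<open>b\<close>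
  at \<open>i\<close>. If all members of \<open>?D\<close> have the opposite sign there,
  \<open>x\<close> is the only recipient.\<close>

lemma sum_weight_axis:
  fixes A :: "(real ^ 'n) set"
  assumes n: "CARD('n) \<ge> 2" and A: "avoids_Dn A" and x: "x \<in> A"
  shows "real CARD('n) - 1 \<le> (\<Sum>p\<in>UNIV. weight A (Inr p) (x + halfaxis p))"
proof -
  let ?D = "{J. x + halfcube J \<in> A}"
  have flip: "\<exists>i. J' = flip i J" if "J \<in> ?D" "J' \<in> ?D" "J \<noteq> J'" for J J'
  proof -
    have "x + halfcube J' + halfcube J - halfcube J' \<in> A" "x + halfcube J' \<in> A"
      using that by (simp_all add: algebra_simps)
    from avoids_halfcube[OF n A this \<open>J \<noteq> J'\<close>] show ?thesis by metis
  qed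
  have "\<exists>i0 J0. \<forall>J\<in>?D. \<forall>i. i \<noteq> i0 \<longrightarrow> (i \<in> J) = (i \<in> J0)"
  proof (cases "\<exists>J\<in>?D. \<exists>J'\<in>?D. J \<noteq> J'")
    case True
    then obtain J i where J: "J \<in> ?D" "flip i J \<in> ?D" using flip by blast
    have "(k \<in> J') = (k \<in> J)" if J': "J' \<in> ?D" "k \<noteq> i" for J' k
    proof (cases "J' = J \<or> J' = flip i J")
      case True
      then show ?thesis using that by (auto simp: flip_def)
    next
      case False
      \<comment> \<open>A third member would be one flip away from both \<open>J\<close> and
        \<open>flip i J\<close>, which the parity of the number of flips forbids.\<close>
      then obtain a b where "J' = flip a J" "J' = flip b (flip i J)"
        using flip J J' by metis
      then have eq: "(m \<in> J \<longleftrightarrow> m \<noteq> a) \<longleftrightarrow> ((m \<in> J \<longleftrightarrow> m \<noteq> i) \<longleftrightarrow> m \<noteq> b)" for m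
        by (auto simp: flip_def set_eq_iff)
      show ?thesis
        using eq[of a] eq[of b] eq[of i] \<open>J' = flip a J\<close> False by metis
    qed
    then show ?thesis by blast
  next
    case False
    \<comment> \<open>With at most one member, any \<open>i0\<close> works; an empty
      \<open>?D\<close> makes the choice of \<open>J0\<close> immaterial.\<close>
    then have "\<forall>J\<in>?D. J = (SOME J. J \<in> ?D)"
      by (metis (no_types, lifting) someI)
    then show ?thesis by metis
  qed
  then obtain i0 J0 where D: "\<And>J i. J \<in> ?D \<Longrightarrow> i \<noteq> i0 \<Longrightarrow> (i \<in> J) = (i \<in> J0)"
    by metis
  let ?h = "\<lambda>i. (i, i \<notin> J0)"
  have one: "weight A (Inr (?h i)) (x + halfaxis (?h i)) = 1" if "i \<noteq> i0" for i
  proof -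
    have "x + halfaxis (?h i) - halfcube J \<notin> A" for J
    proof
      assume "x + halfaxis (?h i) - halfcube J \<in> A"
      then obtain J' where "x + halfcube J' \<in> A" "(i \<in> J') = (i \<notin> J0)"
        using avoids_halfaxis_halfcube[OF n A _ x] by metis
      then show False using D[of J' i] that by simp
    qed
    then have "cube_nbrs A (x + halfaxis (?h i)) = {}"
      by (simp add: cube_nbrs_def)
    moreover have "axis_nbrs A (x + halfaxis (?h i)) = {?h i}"
      using avoids_halfaxis_diff[OF n A _ x, of "?h i"] x by (auto simp: axis_nbrs_def)
    ultimately show ?thesis by (simp add: weight_def)
  qed
  have "real CARD('n) - 1 = real (card (UNIV - {i0}))"
    using n by (simp add: card_Diff_singleton of_nat_diff)
  also have "\<dots> = (\<Sum>i\<in>UNIV - {i0}. weight A (Inr (?h i)) (x + halfaxis (?h i)))"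
    using one by simp
  also have "\<dots> = (\<Sum>p\<in>?h ` (UNIV - {i0}). weight A (Inr p) (x + halfaxis p))"
    by (subst sum.reindex) (auto simp: inj_on_def)
  also have "\<dots> \<le> (\<Sum>p\<in>UNIV. weight A (Inr p) (x + halfaxis p))"
    by (intro sum_mono2) (auto simp: weight_def)
  finally show ?thesis .
qed

text \<open>The neighbour counts are finite sums of indicators of translates of \<open>A\<close>,
  and emptiness means that such a sum vanishes.\<close>

lemma measurable_weight:
  assumes [measurable]: "A \<in> sets borel"
  shows "weight A s \<in> borel_measurable borel"
proof -
  show ?thesis
  proof (cases s)
    case (Inl J)
    then have "weight A s = (\<lambda>v. 1 / (\<Sum>J\<in>UNIV. indicat_real A (v - halfcube J)))"
      by (simp add: fun_eq_iff weight_def card_nbrs)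
    then show ?thesis by simp
  next
    case (Inr p)
    then have "weight A s = (\<lambda>v. if (\<Sum>J\<in>UNIV. indicat_real A (v - halfcube J)) = 0
        then 1 / (\<Sum>p\<in>UNIV. indicat_real A (v - halfaxis p)) else 0)"
      by (simp add: fun_eq_iff weight_def flip: card_nbrs)
    then show ?thesis by simp
  qed
qed

theorem theorem5:
  assumes "CARD('n::finite) \<ge> 4"
  shows "m1 (gauge_norm (voronoi (Dlat :: (real ^ 'n) set)))
           \<le> ereal (1 / ((3/4) * 2 ^ CARD('n) + real CARD('n) - 1))"
proof -
  let ?K = "(3/4) * 2 ^ CARD('n) + real CARD('n) - 1"
  have n: "CARD('n) \<ge> 2" using assms by simp
  have "density A \<le> ereal (1 / ?K)" if "A \<in> sets lebesgue" "avoids_Dn A" for A :: "(real ^ 'n) set"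
  proof (rule density_le_of_mass_transport[where P = avoids_Dn and I = UNIV and g = step and w = weight])
    show "?K \<le> (\<Sum>s\<in>UNIV. weight B s (x + step s))" if "avoids_Dn B" "x \<in> B" for B :: "(real ^ 'n) set" and x
    proof -
      have "(\<Sum>s\<in>UNIV. weight B s (x + step s)) =
        (\<Sum>J\<in>UNIV. weight B (Inl J) (x + halfcube J)) + (\<Sum>p\<in>UNIV. weight B (Inr p) (x + halfaxis p))"
        by (simp add: sum_UNIV_sum step_def)
      then show ?thesis
        using sum_weight_cube[OF n that] sum_weight_axis[OF n that] by simp
    qed
    show "0 < ?K"
      using n by (simp add: add_pos_nonneg add_diff_eq[symmetric])
    show "(\<Sum>s\<in>UNIV. indicator B (v - step s) * weight B s v) \<le> 1" for B :: "(real ^ 'n) set" and v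
      by (rule sum_weight_out)
    show "weight B s v \<ge> 0" for B :: "(real ^ 'n) set" and s v
      by (simp add: weight_def split: sum.split)
    show "avoids_Dn B" if "B \<subseteq> A" for B
      using that \<open>avoids_Dn A\<close> by (auto simp: avoids_dist1_def)
  qed (use that measurable_weight in auto)
  then show ?thesis
    by (auto simp: m1_def intro!: Sup_least)
qed

end
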